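(* Let $k, l \in \mathbb{R}$ be such that $2l - 1 \geq 0$, and let $\mathcal{M}_{k,l}$ be the Whittaker function with indices $k, l$. (a) If $k = 0$, then all nontrivial roots $z$ of $\mathcal{M}_{k,l}$ are purely imaginary. (b) If $k > 0$, then all nontrivial roots $z$ of $\mathcal{M}_{k,l}$ satisfy $\Re(z) > 0$. (c) If $k < 0$, then all nontrivial roots $z$ of $\mathcal{M}_{k,l}$ satisfy $\Re(z) < 0$. (d) If $k \neq 0$, then all nontrivial roots $z$ of $\mathcal{M}_{k,l}$ satisfy $$4 k^2\, \Im(z)^2 - \left(4(l^2 - k^2) - 1\right) \Re(z)^2 > 0.$$ Moreover, in all cases, all non-real roots $z$ of $\mathcal{M}_{k,l}$ satisfy $|z| > \sqrt{4 l^2 - 1}$.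
   Context: For $a, b \in \mathbb{C}$ with $b$ not a nonpositive integer, the Kummer confluent hypergeometric function $\Phi(a,b,\cdot): \mathbb{C} \to \mathbb{C}$ is the entire function $$\Phi(a,b,z) = \sum_{j=0}^{\infty} \frac{(a)_j}{(b)_j} \frac{z^j}{j!},$$ where $(\alpha)_0 = 1$ and $(\alpha)_{j+1} = (\alpha + j)(\alpha)_j$ for $j \in \mathbb{N}$ (Pochhammer symbol, ascending factorial). For $k, l \in \mathbb{C}$ with $2l$ not a negative integer, the Whittaker function $\mathcal{M}_{k,l}$ is defined by $$\mathcal{M}_{k,l}(z) = e^{-z/2} z^{\frac12 + l}\, \Phi\left(\tfrac12 + l - k,\, 1 + 2l,\, z\right).$$ It is in general multi-valued with branch point at $z = 0$, but whether it vanishes at a point $z \neq 0$ does not depend on the branch. A nontrivial root of $\mathcal{M}_{k,l}$ is a root $z \neq 0$; the nontrivial roots of $\mathcal{M}_{k,l}$ are exactly the roots of $\Phi(\frac12 + l - k, 1 + 2l, \cdot)$. $\Re$ and $\Im$ denote real and imaginary parts. *)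

theory Defs
  imports "HOL-Analysis.Analysis"
begin

text \<open>Meaningful when \<open>b\<close> is not a nonpositive integer.\<close>

definition kummer_Phi :: "complex \<Rightarrow> complex \<Rightarrow> complex \<Rightarrow> complex" where
  "kummer_Phi a b z = (\<Sum>j. pochhammer a j / pochhammer b j * (z ^ j / fact j))"

text \<open>
  Meaningful when \<open>2 * l\<close> is not a negative integer. The power is the principal branch
  \<open>exp ((1/2 + l) * Ln z)\<close> for \<open>z \<noteq> 0\<close>. Only the vanishing of the function is of interest here,
  and this is the same for all branches: see \<open>whittaker_M_eq_0_iff_branch\<close>.
\<close>

definition whittaker_M :: "complex \<Rightarrow> complex \<Rightarrow> complex \<Rightarrow> complex" where
  "whittaker_M k l z = exp (- z / 2) * z powr (1/2 + l) * kummer_Phi (1/2 + l - k) (1 + 2 * l) z"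

definition nontrivial_root_whittaker_M :: "complex \<Rightarrow> complex \<Rightarrow> complex \<Rightarrow> bool" where
  "nontrivial_root_whittaker_M k l z \<longleftrightarrow> z \<noteq> 0 \<and> whittaker_M k l z = 0"

lemma whittaker_M_eq_0_iff_branch:
  assumes "exp w = z"
  shows "whittaker_M k l z = 0 \<longleftrightarrow>
           exp (- z / 2) * exp ((1/2 + l) * w) * kummer_Phi (1/2 + l - k) (1 + 2 * l) z = 0"
  using assms by (auto simp: whittaker_M_def)

lemma nontrivial_root_whittaker_M_iff:
  "nontrivial_root_whittaker_M k l z \<longleftrightarrow> kummer_Phi (1/2 + l - k) (1 + 2 * l) z = 0"
proof -
  have "kummer_Phi a b 0 = 1" for a b
    unfolding kummer_Phi_def by (subst suminf_finite[of "{0}"]) auto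
  then show ?thesis
    by (auto simp: nontrivial_root_whittaker_M_def whittaker_M_def)
qed

end

theory Submission
  imports Defs
begin

text \<open>
  Let \<open>z = x + i y\<close> be a root, \<open>m = l + 1/2\<close> and \<open>w(t) = t\<^sup>m g(t)\<close> with
  \<open>g(t) = exp (-t z / 2) \<Phi>(m - k, 2 m, t z)\<close>. Whittaker's equation reads \<open>w'' = q w\<close> with
  \<open>q(t) = z\<^sup>2 / 4 - k z / t + (l\<^sup>2 - 1/4) / t\<^sup>2\<close>. For real \<open>c\<close> the function
  \<open>G = Re ((1 - i c) w\<^sup>* w')\<close>, where the star denotes conjugation, vanishes at \<open>0\<close> and at \<open>1\<close>,
  and \<open>G' = \<bar>w'\<bar>\<^sup>2 + (Re q + c Im q) \<bar>w\<bar>\<^sup>2\<close>. Hence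
  \<open>Re q + c Im q\<close> takes a negative value on \<open>(0, 1)\<close>, whatever \<open>c\<close> is. Each claim follows from a
  suitable choice of \<open>c\<close>.
\<close>

section \<open>The Kummer series: coefficients, convergence, differential equation\<close>

definition kummer_coeff :: "complex \<Rightarrow> complex \<Rightarrow> nat \<Rightarrow> complex" where
  "kummer_coeff a b j = pochhammer a j / (pochhammer b j * fact j)"

lemma kummer_Phi_eq: "kummer_Phi a b z = (\<Sum>j. kummer_coeff a b j * z ^ j)"
  by (simp add: kummer_Phi_def kummer_coeff_def)

lemma add_of_nat_neq_0:
  fixes b :: complex
  assumes "b \<notin> \<int>\<^sub>\<le>\<^sub>0"
  shows "b + of_nat n \<noteq> 0"
proof
  assume "b + of_nat n = 0"
  then have "b = - of_nat n"
    by (simp add: eq_neg_iff_add_eq_0)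
  with assms show False
    by simp
qed

lemma kummer_coeff_Suc:
  assumes "b \<notin> \<int>\<^sub>\<le>\<^sub>0"
  shows "(b + of_nat n) * (of_nat (Suc n) * kummer_coeff a b (Suc n)) = (a + of_nat n) * kummer_coeff a b n"
proof -
  have "pochhammer b n \<noteq> 0"
    using assms by (auto simp: pochhammer_eq_0_iff)
  moreover have "fact (Suc n) = of_nat (Suc n) * (fact n :: complex)"
    by (rule fact_Suc)
  moreover have "of_nat (Suc n) \<noteq> (0 :: complex)"
    by (rule of_nat_neq_0)
  ultimately show ?thesis
    using add_of_nat_neq_0[OF assms, of n]
    unfolding kummer_coeff_def pochhammer_Suc by (simp add: divide_simps del: of_nat_Suc fact_Suc)
qed

lemma summable_kummer:
  assumes "b \<notin> \<int>\<^sub>\<le>\<^sub>0"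
  shows "summable (\<lambda>j. kummer_coeff a b j * z ^ j)"
proof -
  \<comment> \<open>The factor from the \<open>n\<close>-th term to the next; writing
    \<open>(a + n) / (b + n)\<close> as \<open>1 + (a - b) / (b + n)\<close> makes its limit 0
    evident.\<close>
  define r where "r n = (1 + (a - b) / (b + of_nat n)) * (z / of_nat (Suc n))" for n
  have "(\<lambda>n. (a - b) / (b + of_nat n)) \<longlonglongrightarrow> 0"
    by (intro tendsto_divide_0[OF tendsto_const] tendsto_add_filterlim_at_infinity[OF tendsto_const] tendsto_of_nat)
  moreover have "(\<lambda>n. z / of_nat (Suc n)) \<longlonglongrightarrow> 0"
    by (intro LIMSEQ_Suc tendsto_divide_0[OF tendsto_const] tendsto_of_nat)
  ultimately have "r \<longlonglongrightarrow> (1 + 0) * 0"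
    unfolding r_def by (intro tendsto_intros)
  then have "\<forall>\<^sub>F n in sequentially. norm (r n) < 1/2"
    using order_tendstoD(2)[OF tendsto_norm_zero, of r sequentially "1/2"] by simp
  then obtain N where N: "\<And>n. n \<ge> N \<Longrightarrow> norm (r n) < 1/2"
    by (auto simp: eventually_sequentially)
  show ?thesis
  proof (rule summable_ratio_test[of "1/2" N])
    fix n assume "n \<ge> N"
    have "kummer_coeff a b (Suc n) * z ^ Suc n = r n * (kummer_coeff a b n * z ^ n)"
    proof -
      have "of_nat (Suc n) \<noteq> (0 :: complex)"
        by (rule of_nat_neq_0)
      moreover note add_of_nat_neq_0[OF assms, of n] kummer_coeff_Suc[OF assms, of n a]
      ultimately have "kummer_coeff a b (Suc n)
          = (1 + (a - b) / (b + of_nat n)) * kummer_coeff a b n / of_nat (Suc n)"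
        by (simp add: divide_simps mult_ac del: of_nat_Suc)
      then show ?thesis
        by (simp add: r_def mult_ac del: of_nat_Suc)
    qed
    then show "norm (kummer_coeff a b (Suc n) * z ^ Suc n) \<le> 1/2 * norm (kummer_coeff a b n * z ^ n)"
      by (simp only: norm_mult[of "r n"] mult_right_mono[OF less_imp_le[OF N[OF \<open>n \<ge> N\<close>]] norm_ge_zero])
  qed simp
qed

text \<open>Termwise differentiation turns the equation into the recurrence
  \<open>kummer_coeff_Suc\<close> for the coefficient of each power \<open>z ^ n\<close>.\<close>

lemma kummer_ode:
  assumes "b \<notin> \<int>\<^sub>\<le>\<^sub>0"
  obtains f' f'' where
    "\<And>z. (kummer_Phi a b has_field_derivative f' z) (at z)"
    "\<And>z. (f' has_field_derivative f'' z) (at z)"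
    "\<And>z. z * f'' z + (b - z) * f' z - a * kummer_Phi a b z = 0"
proof
  let ?c = "kummer_coeff a b"
  let ?f' = "\<lambda>z. \<Sum>n. diffs ?c n * z ^ n"
  let ?f'' = "\<lambda>z. \<Sum>n. diffs (diffs ?c) n * z ^ n"
  have s0: "summable (\<lambda>n. ?c n * z ^ n)" for z
    by (rule summable_kummer[OF assms])
  have s1: "summable (\<lambda>n. diffs ?c n * z ^ n)" for z
    by (rule termdiff_converges_all[OF s0])
  have s2: "summable (\<lambda>n. diffs (diffs ?c) n * z ^ n)" for z
    by (rule termdiff_converges_all[OF s1])
  show "(kummer_Phi a b has_field_derivative ?f' z) (at z)" for z
    unfolding kummer_Phi_eq[abs_def] by (rule termdiffs_strong_converges_everywhere[OF s0])
  show "(?f' has_field_derivative ?f'' z) (at z)" for z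
    by (rule termdiffs_strong_converges_everywhere[OF s1])
  show "z * ?f'' z + (b - z) * ?f' z - a * kummer_Phi a b z = 0" for z
  proof -
    \<comment> \<open>The operator \<open>z d/dz\<close> multiplies the \<open>n\<close>-th
      coefficient by \<open>n\<close>; the index can start at 0 because that term vanishes.\<close>
    have shift: "(\<lambda>n. of_nat n * d n * z ^ n) sums (z * (\<Sum>n. diffs d n * z ^ n))"
      if "summable (\<lambda>n. diffs d n * z ^ n)" for d
    proof -
      have "(\<lambda>n. z * (diffs d n * z ^ n)) sums (z * (\<Sum>n. diffs d n * z ^ n))"
        using that by (intro sums_mult summable_sums)
      then have "(\<lambda>n. of_nat (Suc n) * d (Suc n) * z ^ Suc n) sums (z * (\<Sum>n. diffs d n * z ^ n))"
        by (simp add: diffs_def mult_ac)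
      then show ?thesis
        by (subst (asm) sums_Suc_iff) simp
    qed
    have "(\<lambda>n. of_nat n * diffs ?c n * z ^ n + b * (diffs ?c n * z ^ n)
             - of_nat n * ?c n * z ^ n - a * (?c n * z ^ n))
          sums (z * ?f'' z + b * ?f' z - z * ?f' z - a * kummer_Phi a b z)"
      unfolding kummer_Phi_eq
      by (intro sums_add sums_diff sums_mult shift summable_sums s0 s1 s2)
    also have "(\<lambda>n. of_nat n * diffs ?c n * z ^ n + b * (diffs ?c n * z ^ n)
             - of_nat n * ?c n * z ^ n - a * (?c n * z ^ n)) = (\<lambda>n. 0)"
    proof
      fix n
      have "X * (D * Y) + b * (D * Y) - X * (C * Y) - a * (C * Y) = 0"
        if "(b + X) * D = (a + X) * C" for X C D Y :: complex
        using that by algebra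
      from this[OF kummer_coeff_Suc[OF assms]]
      show "of_nat n * diffs ?c n * z ^ n + b * (diffs ?c n * z ^ n)
          - of_nat n * ?c n * z ^ n - a * (?c n * z ^ n) = 0"
        by (simp only: diffs_def mult.assoc)
    qed
    finally have "(\<lambda>n. 0) sums (z * ?f'' z + b * ?f' z - z * ?f' z - a * kummer_Phi a b z)" .
    then have "z * ?f'' z + b * ?f' z - z * ?f' z - a * kummer_Phi a b z = 0"
      using sums_zero by (rule sums_unique2)
    then show ?thesis
      by (simp add: algebra_simps)
  qed
qed

section \<open>Whittaker's equation on the segment from 0 to the root\<close>

text \<open>This is Whittaker's equation for \<open>w = t\<^sup>m g\<close> with the branch point at \<open>t = 0\<close> removed.\<close>

lemma whittaker_ode_along_ray:
  fixes k m :: real and z :: complex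
  assumes "m > 0"
  defines "g \<equiv> \<lambda>t. exp (- (of_real t * z) / 2) * kummer_Phi (of_real (m - k)) (of_real (2 * m)) (of_real t * z)"
  obtains g' g'' where
    "\<And>t. (g has_vector_derivative g' t) (at t)"
    "\<And>t. (g' has_vector_derivative g'' t) (at t)"
    "\<And>t. of_real t * g'' t + of_real (2 * m) * g' t = (of_real t * z\<^sup>2 / 4 - of_real k * z) * g t"
proof -
  have "complex_of_real (2 * m) \<notin> \<int>\<^sub>\<le>\<^sub>0"
    using assms(1) by (auto elim!: nonpos_Ints_cases simp: complex_eq_iff)
  then obtain f' f'' where f':
      "\<And>z. (kummer_Phi (of_real (m - k)) (of_real (2 * m)) has_field_derivative f' z) (at z)"
    and f'': "\<And>z. (f' has_field_derivative f'' z) (at z)"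
    and ode: "\<And>z. z * f'' z + (of_real (2 * m) - z) * f' z
      - of_real (m - k) * kummer_Phi (of_real (m - k)) (of_real (2 * m)) z = 0"
    using kummer_ode by blast
  let ?f = "kummer_Phi (of_real (m - k)) (of_real (2 * m))"
  let ?e = "\<lambda>u. exp (- u / 2) :: complex"
  define h where "h u = ?e u * ?f u" for u
  define h' where "h' u = ?e u * (f' u - ?f u / 2)" for u
  define h'' where "h'' u = ?e u * (f'' u - f' u + ?f u / 4)" for u
  have h': "(h has_field_derivative h' u) (at u)" for u
    unfolding h_def h'_def
    by (rule derivative_eq_intros f' refl | simp add: algebra_simps)+
  have h'': "(h' has_field_derivative h'' u) (at u)" for u
    unfolding h'_def h''_def
    by (rule derivative_eq_intros f' f'' refl | simp add: algebra_simps)+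
  have ray: "((\<lambda>t. F (of_real t * z)) has_vector_derivative z * F' (of_real t * z)) (at t)"
    if "\<And>u. (F has_field_derivative F' u) (at u)" for F F' and t :: real
  proof -
    have "((\<lambda>t. of_real t * z) has_vector_derivative z) (at t)"
      by (rule derivative_eq_intros refl | simp)+
    from field_vector_diff_chain_at[OF this that] show ?thesis
      by (simp add: o_def)
  qed
  have g_h: "g t = h (of_real t * z)" for t
    by (simp add: g_def h_def)
  show ?thesis
  proof
    show "(g has_vector_derivative z * h' (of_real t * z)) (at t)" for t
      unfolding g_h[abs_def] by (rule ray[OF h'])
    show "((\<lambda>t. z * h' (of_real t * z)) has_vector_derivative z * (z * h'' (of_real t * z))) (at t)" for t
      by (intro has_vector_derivative_mult_right ray[OF h''])
    show "of_real t * (z * (z * h'' (of_real t * z))) + of_real (2 * m) * (z * h' (of_real t * z))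
        = (of_real t * z\<^sup>2 / 4 - of_real k * z) * g t" for t
    proof -
      define u where "u = of_real t * z"
      \<comment> \<open>The factor \<open>exp (- u / 2)\<close> cancels the term
        \<open>- u * f' u\<close> of Kummer's equation, at the price of the potential term
        \<open>u / 4\<close>.\<close>
      have "u * h'' u + of_real (2 * m) * h' u - (u / 4 - of_real k) * h u
          = ?e u * (u * f'' u + (of_real (2 * m) - u) * f' u - of_real (m - k) * ?f u)"
        unfolding h_def h'_def h''_def by (simp add: field_simps)
      then have "u * h'' u + of_real (2 * m) * h' u = (u / 4 - of_real k) * h u"
        using ode by simp
      then have "z * (u * h'' u + of_real (2 * m) * h' u) = z * ((u / 4 - of_real k) * h u)"
        by (rule arg_cong)
      then show ?thesis
        unfolding g_h u_def by (simp add: algebra_simps power2_eq_square)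
    qed
  qed
qed

section \<open>The monotonicity argument for \<open>G\<close>\<close>

lemma kummer_Phi_0 [simp]: "kummer_Phi a b 0 = 1"
  unfolding kummer_Phi_def by (subst suminf_finite[of "{0}"]) auto

lemma Re_real_combination: "a * Re x + t * Re y = Re (of_real a * x + of_real t * y)"
  by simp

text \<open>The expression is \<open>t\<^sup>2 (Re q + c Im q)\<close>.\<close>

lemma nontrivial_root_potential_negative:
  fixes k l c :: real and z :: complex
  assumes l: "l \<ge> 1/2"
    and root: "nontrivial_root_whittaker_M (of_real k) (of_real l) z"
  shows "\<exists>t. 0 < t \<and> t < 1 \<and>
    ((Re z)\<^sup>2 - (Im z)\<^sup>2) / 4 * t\<^sup>2 - k * Re z * t + (l\<^sup>2 - 1/4)
      + c * Im z * (Re z / 2 * t\<^sup>2 - k * t) < 0"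
proof (rule ccontr)
  define V where "V t = ((Re z)\<^sup>2 - (Im z)\<^sup>2) / 4 * t\<^sup>2 - k * Re z * t + (l\<^sup>2 - 1/4)
      + c * Im z * (Re z / 2 * t\<^sup>2 - k * t)" for t
  assume "\<not> ?thesis"
  then have V: "V t \<ge> 0" if "0 < t" "t < 1" for t
    using that unfolding V_def by (meson not_less)
  define m where "m = l + 1/2"
  define g where "g t = exp (- (of_real t * z) / 2)
    * kummer_Phi (of_real (m - k)) (of_real (2 * m)) (of_real t * z)" for t
  have "m > 0"
    using l by (simp add: m_def)
  then obtain g' g'' where g': "\<And>t. (g has_vector_derivative g' t) (at t)"
    and g'': "\<And>t. (g' has_vector_derivative g'' t) (at t)"
    and ode: "\<And>t. of_real t * g'' t + of_real (2 * m) * g' t = (of_real t * z\<^sup>2 / 4 - of_real k * z) * g t"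
    using whittaker_ode_along_ray[of m z k] unfolding g_def[abs_def] by blast
  have g1: "g 1 = 0"
    using root by (simp add: g_def nontrivial_root_whittaker_M_iff m_def algebra_simps)
  have g0: "g 0 = 1"
    by (simp add: g_def)
  \<comment> \<open>\<open>w' = t\<^bsup>m-1\<^esup> u\<close>\<close>
  define u where "u t = of_real m * g t + of_real t * g' t" for t
  define u' where "u' t = of_real m * g' t + (g' t + of_real t * g'' t)" for t
  have u': "(u has_vector_derivative u' t) (at t)" for t
    unfolding u_def u'_def by (rule derivative_eq_intros g' g'' refl | simp add: algebra_simps)+
  \<comment> \<open>With \<open>2 * m - 1 = 2 * l\<close>, the product of the conjugate of
    \<open>w\<close> with \<open>w'\<close> is \<open>t powr (2 * l)\<close> times
    \<open>cnj (g t) * u t\<close>. So \<open>p\<close> is differentiable at 0 too, and the power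
    carries all the singular behaviour.\<close>
  define p where "p t = Re ((1 - \<i> * of_real c) * (cnj (g t) * u t))" for t
  define p' where "p' t = Re ((1 - \<i> * of_real c) * (cnj (g t) * u' t + cnj (g' t) * u t))" for t
  have p': "(p has_real_derivative p' t) (at t)" for t
    unfolding p_def p'_def has_real_derivative_iff_has_vector_derivative
    by (intro bounded_linear.has_vector_derivative[OF bounded_linear_Re]
        has_vector_derivative_mult_right has_vector_derivative_mult
        has_vector_derivative_cnj g' u')
  define G where "G t = t powr (2 * l) * p t" for t
  \<comment> \<open>Both squares share the factor \<open>t powr (2 * m - 2)\<close>, which is
    \<open>t powr (2 * l - 1)\<close>; the \<open>t\<^sup>2\<close> in \<open>V\<close> clears the
    denominators of \<open>q\<close>.\<close>
  define G' where "G' t = t powr (2 * l - 1) * ((cmod (u t))\<^sup>2 + V t * (cmod (g t))\<^sup>2)" for t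
  have G': "(G has_real_derivative G' t) (at t)" if "t > 0" for t
  proof -
    have "(G has_real_derivative 2 * l * t powr (2 * l - 1) * p t + p' t * t powr (2 * l)) (at t)"
      unfolding G_def using that
      by (intro DERIV_mult p') (auto intro!: derivative_eq_intros simp: field_simps)
    also have "t powr (2 * l) = t powr (2 * l - 1) * t"
      using that by (simp add: powr_diff)
    also have "2 * l * t powr (2 * l - 1) * p t + p' t * (t powr (2 * l - 1) * t)
        = t powr (2 * l - 1) * (2 * l * p t + t * p' t)"
      by (simp add: algebra_simps)
    also have "2 * l * p t + t * p' t = (cmod (u t))\<^sup>2 + V t * (cmod (g t))\<^sup>2"
    proof -
      \<comment> \<open>Multiplied by \<open>t\<close>, all derivatives can be expressed through
        \<open>g t\<close> and \<open>u t\<close> alone, the second one by means of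
        \<open>ode\<close>.\<close>
      have tg': "of_real t * g' t = u t - of_real m * g t"
        by (simp add: u_def)
      have "of_real t * g'' t = (of_real t * z\<^sup>2 / 4 - of_real k * z) * g t - of_real (2 * m) * g' t"
        using ode[of t] by (simp add: algebra_simps)
      then have "u' t = (of_real t * z\<^sup>2 / 4 - of_real k * z) * g t + of_real (1 - m) * g' t"
        unfolding u'_def by (simp add: algebra_simps)
      then have tu': "of_real t * u' t = of_real t * (of_real t * z\<^sup>2 / 4 - of_real k * z) * g t
          + of_real (1 - m) * (u t - of_real m * g t)"
        unfolding tg'[symmetric] by (simp only: distrib_left mult.left_commute mult.assoc)
      have tcg': "of_real t * cnj (g' t) = cnj (u t) - of_real m * cnj (g t)"
        using arg_cong[OF tg', of cnj] by simp
      have "2 * l * p t + t * p' t = Re (of_real (2 * l) * ((1 - \<i> * of_real c) * (cnj (g t) * u t))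
          + of_real t * ((1 - \<i> * of_real c) * (cnj (g t) * u' t + cnj (g' t) * u t)))"
        unfolding p_def p'_def by (rule Re_real_combination)
      also have "\<dots> = Re ((1 - \<i> * of_real c) *
          (2 * of_real l * (cnj (g t) * u t)
            + (cnj (g t) * (of_real t * u' t) + (of_real t * cnj (g' t)) * u t)))"
        by (simp only: of_real_mult of_real_numeral ring_distribs mult_ac)
      \<comment> \<open>The mixed term \<open>cnj (g t) * u t\<close> drops out, its coefficient
        being \<open>2 * l + (1 - m) - m = 0\<close>; the constant arises as
        \<open>- m * (1 - m) = l\<^sup>2 - 1/4\<close>.\<close>
      also have "2 * of_real l * (cnj (g t) * u t)
            + (cnj (g t) * (of_real t * u' t) + (of_real t * cnj (g' t)) * u t)
          = u t * cnj (u t) + ((of_real t)\<^sup>2 * z\<^sup>2 / 4 - of_real k * of_real t * z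
              + ((of_real l)\<^sup>2 - 1/4)) * (g t * cnj (g t))"
      proof -
        have "2 * complex_of_real m = 2 * of_real l + 1"
          by (simp add: m_def)
        then show ?thesis
          unfolding tu' tcg' of_real_diff of_real_1 by algebra
      qed
      also have "\<dots> = of_real ((cmod (u t))\<^sup>2) + (of_real (t\<^sup>2) * z\<^sup>2 / 4 - of_real (k * t) * z
          + of_real (l\<^sup>2 - 1/4)) * of_real ((cmod (g t))\<^sup>2)"
        unfolding complex_norm_square by simp
      also have "Re ((1 - \<i> * of_real c) * \<dots>) = (cmod (u t))\<^sup>2 + V t * (cmod (g t))\<^sup>2"
      proof -
        have "Re ((1 - \<i> * of_real c) * (of_real A + (of_real (t\<^sup>2) * z\<^sup>2 / 4 - of_real (k * t) * z
              + of_real L) * of_real N))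
            = A + (((Re z)\<^sup>2 - (Im z)\<^sup>2) / 4 * t\<^sup>2 - k * Re z * t + L
              + c * Im z * (Re z / 2 * t\<^sup>2 - k * t)) * N" for A L N
          by (simp add: Re_power2 Im_power2 algebra_simps diff_divide_distrib)
        then show ?thesis
          unfolding V_def .
      qed
      finally show ?thesis .
    qed
    finally show ?thesis
      by (simp add: G'_def)
  qed
  have cont_p: "continuous_on A p" for A
    using p' by (meson DERIV_continuous_on has_field_derivative_at_within)
  have "continuous_on {0..1} (\<lambda>t :: real. t powr (2 * l))"
    using l by (intro continuous_on_powr' continuous_intros) auto
  then have cont_G: "continuous_on {0..1} G"
    unfolding G_def by (intro continuous_on_mult cont_p)
  have mono: "G s \<le> G t" if "0 \<le> s" "s \<le> t" "t \<le> 1" for s t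
  proof (rule DERIV_nonneg_imp_increasing_open[OF that(2)])
    fix x assume x: "s < x" "x < t"
    then have "G' x \<ge> 0"
      using V[of x] that by (simp add: G'_def)
    then show "\<exists>y. (G has_real_derivative y) (at x) \<and> 0 \<le> y"
      using G'[of x] that x by (intro exI[of _ "G' x"]) auto
  next
    show "continuous_on {s..t} G"
      using that by (intro continuous_on_subset[OF cont_G]) auto
  qed
  \<comment> \<open>At 0 the power vanishes, at 1 the factor \<open>g\<close>. A monotone function
    with equal end values is constant, so both summands of \<open>G'\<close> vanish inside.\<close>
  have "G 0 = 0" "G 1 = 0"
    by (simp_all add: G_def p_def g1)
  then have G0: "G t = 0" if "0 \<le> t" "t \<le> 1" for t
    using mono[of 0 t] mono[of t 1] that by simp
  have u0: "u t = 0" if "t \<in> {0<..<1}" for t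
  proof -
    have "(G has_real_derivative 0) (at t)"
      using has_field_derivative_transform_within_open[of "\<lambda>_. 0" 0 t "{0<..<1}" G] that G0
      by auto
    then have "G' t = 0"
      using G'[of t] that by (auto dest: DERIV_unique)
    then have "(cmod (u t))\<^sup>2 + V t * (cmod (g t))\<^sup>2 = 0"
      using that by (simp add: G'_def)
    moreover have "V t * (cmod (g t))\<^sup>2 \<ge> 0"
      using V[of t] that by simp
    ultimately show "u t = 0"
      by (smt (verit) norm_eq_zero zero_eq_power2 zero_le_power2)
  qed
  \<comment> \<open>By continuity \<open>u 0 = 0\<close>, whereas the normalisation
    \<open>g 0 = 1\<close> gives \<open>u 0 = m > 0\<close>.\<close>
  have "continuous (at_right 0) u"
    using has_vector_derivative_continuous[OF u'] by (rule continuous_at_imp_continuous_at_within)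
  then have "(u \<longlongrightarrow> u 0) (at_right 0)"
    by (simp add: continuous_within)
  moreover have "\<forall>\<^sub>F t in at_right 0. u t = 0"
    using eventually_at_right_real[of 0 1] by (rule eventually_mono) (auto intro: u0)
  ultimately have "u 0 = 0"
    by (metis tendsto_eventually tendsto_unique trivial_limit_at_right_real)
  with \<open>m > 0\<close> show False
    by (simp add: u_def g0)
qed

section \<open>The choices of \<open>c\<close>\<close>

theorem proposition4:
  fixes k l :: real
  assumes "2 * l - 1 \<ge> 0"
  shows "(k = 0 \<longrightarrow>
            (\<forall>z. nontrivial_root_whittaker_M (of_real k) (of_real l) z \<longrightarrow> Re z = 0)) \<and>
         (k > 0 \<longrightarrow>
            (\<forall>z. nontrivial_root_whittaker_M (of_real k) (of_real l) z \<longrightarrow> Re z > 0)) \<and>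
         (k < 0 \<longrightarrow>
            (\<forall>z. nontrivial_root_whittaker_M (of_real k) (of_real l) z \<longrightarrow> Re z < 0)) \<and>
         (k \<noteq> 0 \<longrightarrow>
            (\<forall>z. nontrivial_root_whittaker_M (of_real k) (of_real l) z \<longrightarrow>
               4 * k\<^sup>2 * (Im z)\<^sup>2 - (4 * (l\<^sup>2 - k\<^sup>2) - 1) * (Re z)\<^sup>2 > 0)) \<and>
         (\<forall>z. whittaker_M (of_real k) (of_real l) z = 0 \<and> z \<notin> \<real> \<longrightarrow>
            cmod z > sqrt (4 * l\<^sup>2 - 1))"
proof -
  have l: "l \<ge> 1/2"
    using assms by simp
  then have "l\<^sup>2 \<ge> (1/2)\<^sup>2"
    by (intro power_mono) auto
  then have L: "l\<^sup>2 - 1/4 \<ge> 0"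
    by (simp add: power2_eq_square)
  let ?root = "nontrivial_root_whittaker_M (of_real k) (of_real l)"
  note neg = nontrivial_root_potential_negative[OF l]
  have imaginary: "Re z = 0" if "k = 0" and root: "?root z" for z
  proof (rule ccontr)
    assume "Re z \<noteq> 0"
    \<comment> \<open>This \<open>c\<close> makes the contribution of \<open>Im q\<close> cancel the
      negative term \<open>- (Im z)\<^sup>2 / 4 * t\<^sup>2\<close>.\<close>
    obtain t where "((Re z)\<^sup>2 - (Im z)\<^sup>2) / 4 * t\<^sup>2 + (l\<^sup>2 - 1/4)
        + Im z / (2 * Re z) * Im z * (Re z / 2 * t\<^sup>2) < 0"
      using neg[OF root, of "Im z / (2 * Re z)"] \<open>k = 0\<close> by auto
    also have "Im z / (2 * Re z) * Im z * (Re z / 2 * t\<^sup>2) = (Im z)\<^sup>2 / 4 * t\<^sup>2"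
      using \<open>Re z \<noteq> 0\<close> by (simp add: power2_eq_square)
    finally have "(Re z)\<^sup>2 / 4 * t\<^sup>2 + (l\<^sup>2 - 1/4) < 0"
      by (simp add: algebra_simps diff_divide_distrib)
    moreover have "(Re z)\<^sup>2 / 4 * t\<^sup>2 \<ge> 0"
      by simp
    ultimately show False
      using L by linarith
  qed
  have sign: "k * Re z > 0" if "k \<noteq> 0" and root: "?root z" for z
  proof (rule ccontr)
    assume "\<not> k * Re z > 0"
    then have le: "k * Re z \<le> 0"
      by simp
    \<comment> \<open>This \<open>c\<close> turns \<open>- c * Im z * k * t\<close> into
      \<open>(Im z)\<^sup>2 / 4 * t\<close>, which outweighs
      \<open>(Im z)\<^sup>2 / 4 * t\<^sup>2\<close> since \<open>t < 1\<close>. The remaining term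
      \<open>E\<close> has the sign of \<open>- (k * Re z)\<close> or is 0.\<close>
    obtain t where t: "0 < t" "t < 1" and
      V: "((Re z)\<^sup>2 - (Im z)\<^sup>2) / 4 * t\<^sup>2 - k * Re z * t + (l\<^sup>2 - 1/4)
        + - Im z / (4 * k) * Im z * (Re z / 2 * t\<^sup>2 - k * t) < 0"
      using neg[OF root, of "- Im z / (4 * k)"] by blast
    define E where "E = (Im z)\<^sup>2 * t\<^sup>2 / (8 * k\<^sup>2) * - (k * Re z)"
    have "- Im z / (4 * k) * Im z * (Re z / 2 * t\<^sup>2 - k * t) = (Im z)\<^sup>2 / 4 * t + E"
      using that(1) by (simp add: E_def field_simps power2_eq_square)
    moreover have "((Re z)\<^sup>2 - (Im z)\<^sup>2) / 4 * t\<^sup>2 - k * Re z * t + (Im z)\<^sup>2 / 4 * t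
        = (Re z)\<^sup>2 / 4 * t\<^sup>2 + (Im z)\<^sup>2 / 4 * (t * (1 - t)) + t * - (k * Re z)"
      by (simp add: field_simps power2_eq_square)
    moreover have "(Re z)\<^sup>2 / 4 * t\<^sup>2 \<ge> 0" "(Im z)\<^sup>2 / 4 * (t * (1 - t)) \<ge> 0"
      using t by simp_all
    moreover have "t * - (k * Re z) \<ge> 0"
      using t le by (intro mult_nonneg_nonneg) simp_all
    moreover have "E \<ge> 0"
      unfolding E_def using le by (intro mult_nonneg_nonneg) simp_all
    ultimately show False
      using L V by linarith
  qed
  have cone: "4 * k\<^sup>2 * (Im z)\<^sup>2 - (4 * (l\<^sup>2 - k\<^sup>2) - 1) * (Re z)\<^sup>2 > 0" if "k \<noteq> 0" and root: "?root z" for z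
  proof (rule ccontr)
    define r where "r = (Re z)\<^sup>2 + (Im z)\<^sup>2"
    assume "\<not> ?thesis"
    then have le: "k\<^sup>2 * r \<le> (l\<^sup>2 - 1/4) * (Re z)\<^sup>2"
      by (simp add: r_def algebra_simps)
    have x: "Re z \<noteq> 0"
      using sign[OF that] by auto
    \<comment> \<open>Here \<open>1 - i c\<close> is \<open>cnj z / Re z\<close>, so that
      \<open>z\<close> times this factor is real. After multiplication by
      \<open>(Re z)\<^sup>2\<close> the square in \<open>t\<close> can be completed, and
      \<open>le\<close> says that the remainder is nonnegative.\<close>
    obtain t where t: "((Re z)\<^sup>2 - (Im z)\<^sup>2) / 4 * t\<^sup>2 - k * Re z * t + (l\<^sup>2 - 1/4)
        + Im z / Re z * Im z * (Re z / 2 * t\<^sup>2 - k * t) < 0"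
      using neg[OF root, of "Im z / Re z"] by blast
    have "(((Re z)\<^sup>2 - (Im z)\<^sup>2) / 4 * t\<^sup>2 - k * Re z * t + (l\<^sup>2 - 1/4)
        + Im z / Re z * Im z * (Re z / 2 * t\<^sup>2 - k * t)) * (Re z)\<^sup>2
        = r * (Re z * t / 2 - k)\<^sup>2 + ((l\<^sup>2 - 1/4) * (Re z)\<^sup>2 - k\<^sup>2 * r)"
      using x by (simp add: r_def field_simps power2_eq_square)
    also have "\<dots> \<ge> 0"
      using le by (simp add: r_def)
    finally show False
      using t x by (simp add: zero_le_mult_iff)
  qed
  have modulus: "cmod z > sqrt (4 * l\<^sup>2 - 1)"
    if "whittaker_M (of_real k) (of_real l) z = 0" "z \<notin> \<real>" for z
  proof (rule ccontr)
    assume "\<not> ?thesis"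
    then have "(cmod z)\<^sup>2 \<le> (sqrt (4 * l\<^sup>2 - 1))\<^sup>2"
      by (intro power_mono) auto
    then have le: "(Re z)\<^sup>2 + (Im z)\<^sup>2 \<le> 4 * (l\<^sup>2 - 1/4)"
      using L by (simp add: cmod_power2)
    have y: "Im z \<noteq> 0"
      using that(2) by (auto simp: complex_is_Real_iff)
    have root: "?root z"
      using that by (auto simp: nontrivial_root_whittaker_M_def)
    \<comment> \<open>Here \<open>1 - i c\<close> is \<open>i * cnj z / Im z\<close>. Its product
      with \<open>z\<close> is purely imaginary, so \<open>k\<close> disappears from the
      inequality.\<close>
    obtain t where t: "0 < t" "t < 1" and
      "((Re z)\<^sup>2 - (Im z)\<^sup>2) / 4 * t\<^sup>2 - k * Re z * t + (l\<^sup>2 - 1/4)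
        + - Re z / Im z * Im z * (Re z / 2 * t\<^sup>2 - k * t) < 0"
      using neg[OF root, of "- Re z / Im z"] by blast
    then have "(l\<^sup>2 - 1/4) - ((Re z)\<^sup>2 + (Im z)\<^sup>2) / 4 * t\<^sup>2 < 0"
      using y by (simp add: field_simps power2_eq_square)
    moreover have "((Re z)\<^sup>2 + (Im z)\<^sup>2) / 4 * t\<^sup>2 \<le> (l\<^sup>2 - 1/4) * 1"
      using le t L by (intro mult_mono) (auto simp: power_le_one)
    ultimately show False
      by simp
  qed
  show ?thesis
    using imaginary sign cone modulus by (auto simp: zero_less_mult_iff)
qed

end
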